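(* Every degree-$3$ tropical rational map $\varphi$ with slope sequence $(3,5,3)$ or $(3,1,3)$ satisfies $\mathrm{Aut}(\varphi)\cong\mathbb{Z}/2\mathbb{Z}$.
   Context: The tropical projective line is $\mathbb{T}\mathbb{P}^1=\mathbb{R}\cup\{-\infty,+\infty\}$; its automorphism group $\mathrm{Aut}(\mathbb{T}\mathbb{P}^1)$ consists of the maps $x\mapsto\varepsilon x+b$, $\varepsilon\in\{\pm1\}$, $b\in\mathbb{R}$. A degree-$3$ tropical rational map is a continuous piecewise-linear function $\varphi:\mathbb{R}\to\mathbb{R}$ (extended to $\mathbb{T}\mathbb{P}^1\to\mathbb{T}\mathbb{P}^1$) with integer slopes and finitely many break points $x_1<\dots<x_k$ whose slope sequence $(s_0,\dots,s_k)$ ($s_i$ the slope on $(x_i,x_{i+1})$, $x_0=-\infty$, $x_{k+1}=+\infty$, consecutive slopes distinct) satisfies $s_0=s_k=3$ and $\sum_{i=1}^k|s_i-s_{i-1}|=4$. The automorphism group of $\varphi$ is $$\mathrm{Aut}(\varphi)=\{(\alpha,\beta)\in\mathrm{Aut}(\mathbb{T}\mathbb{P}^1)\times\mathrm{Aut}(\mathbb{T}\mathbb{P}^1) : \beta\circ\varphi=\varphi\circ\alpha\}.$$ *)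

theory Defs
  imports "HOL-Library.Extended_Real" "HOL-Algebra.Elementary_Groups"
begin

text \<open>The tropical projective line is the type \<^typ>\<open>ereal\<close>.\<close>

definition TP1_map :: "real \<Rightarrow> real \<Rightarrow> ereal \<Rightarrow> ereal" where
  "TP1_map e b x = ereal e * x + ereal b"

definition Aut_TP1 :: "(ereal \<Rightarrow> ereal) monoid" where
  "Aut_TP1 = \<lparr>carrier = {TP1_map e b | e b. e \<in> {1, -1}}, mult = (\<circ>), one = id\<rparr>"

text \<open>\<open>slopes f xs ss\<close>: \<open>f\<close> is continuous and piecewise linear with break points
  \<open>xs = [x\<^sub>1, \<dots>, x\<^sub>k]\<close> and slopes \<open>ss = [s\<^sub>0, \<dots>, s\<^sub>k]\<close>. Lists are indexed from 0, so
  \<open>xs ! i\<close> is \<open>x\<^sub>i\<^sub>+\<^sub>1\<close>; the piece of slope \<open>ss ! i\<close> is unbounded to the left for \<open>i = 0\<close> and to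
  the right for \<open>i = k\<close>.\<close>

definition piece :: "real list \<Rightarrow> nat \<Rightarrow> real set" where
  "piece xs i = {t. (0 < i \<longrightarrow> xs ! (i - 1) < t) \<and> (i < length xs \<longrightarrow> t < xs ! i)}"

definition slopes :: "(real \<Rightarrow> real) \<Rightarrow> real list \<Rightarrow> int list \<Rightarrow> bool" where
  "slopes f xs ss \<longleftrightarrow>
     continuous_on UNIV f \<and>
     sorted_wrt (<) xs \<and>
     length ss = length xs + 1 \<and>
     (\<forall>i \<le> length xs. \<exists>c. \<forall>t \<in> piece xs i. f t = of_int (ss ! i) * t + c) \<and>
     (\<forall>i < length xs. ss ! i \<noteq> ss ! (i + 1))"

definition slope_sequence :: "(real \<Rightarrow> real) \<Rightarrow> int list \<Rightarrow> bool" where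
  "slope_sequence f ss \<longleftrightarrow> (\<exists>xs. slopes f xs ss)"

definition tropical_rational_map_deg3 :: "(real \<Rightarrow> real) \<Rightarrow> bool" where
  "tropical_rational_map_deg3 f \<longleftrightarrow>
     (\<exists>ss. slope_sequence f ss \<and> hd ss = 3 \<and> last ss = 3 \<and>
           (\<Sum>i = 1..<length ss. \<bar>ss ! i - ss ! (i - 1)\<bar>) = 4)"

text \<open>The extension to the points at infinity is by limits.\<close>

definition extend_TP1 :: "(real \<Rightarrow> real) \<Rightarrow> ereal \<Rightarrow> ereal" where
  "extend_TP1 f x = (case x of
       ereal r \<Rightarrow> ereal (f r)
     | PInfty \<Rightarrow> Lim at_top (\<lambda>t. ereal (f t))
     | MInfty \<Rightarrow> Lim at_bot (\<lambda>t. ereal (f t)))"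

definition Aut_map :: "(real \<Rightarrow> real) \<Rightarrow> ((ereal \<Rightarrow> ereal) \<times> (ereal \<Rightarrow> ereal)) monoid" where
  "Aut_map f = (Aut_TP1 \<times>\<times> Aut_TP1)
     \<lparr>carrier := {(\<alpha>, \<beta>) \<in> carrier Aut_TP1 \<times> carrier Aut_TP1.
                    \<beta> \<circ> extend_TP1 f = extend_TP1 f \<circ> \<alpha>}\<rparr>"

lemma TP1_map_comp:
  assumes "e \<in> {1, -1}" "e' \<in> {1, -1}"
  shows "TP1_map e b \<circ> TP1_map e' b' = TP1_map (e * e') (e * b' + b)"
proof
  fix x
  show "(TP1_map e b \<circ> TP1_map e' b') x = TP1_map (e * e') (e * b' + b) x"
    using assms by (cases x) (auto simp: TP1_map_def)
qed

lemma TP1_map_id: "TP1_map 1 0 = id"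
  by (auto simp: TP1_map_def fun_eq_iff zero_ereal_def[symmetric] one_ereal_def[symmetric])

lemma group_Aut_TP1: "group Aut_TP1"
proof (rule groupI)
  fix x assume "x \<in> carrier Aut_TP1"
  then obtain e b where x: "x = TP1_map e b" "e \<in> {1, -1}"
    by (auto simp: Aut_TP1_def)
  then have "TP1_map e (- (e * b)) \<circ> x = id"
    by (auto simp: TP1_map_comp TP1_map_id[symmetric])
  moreover have "TP1_map e (- (e * b)) \<in> carrier Aut_TP1"
    using x by (auto simp: Aut_TP1_def)
  ultimately show "\<exists>y \<in> carrier Aut_TP1. y \<otimes>\<^bsub>Aut_TP1\<^esub> x = \<one>\<^bsub>Aut_TP1\<^esub>"
    by (auto simp: Aut_TP1_def)
next
  fix x y assume "x \<in> carrier Aut_TP1" "y \<in> carrier Aut_TP1"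
  then obtain e b e' b' where "x = TP1_map e b" "e \<in> {1, -1}" "y = TP1_map e' b'" "e' \<in> {1, -1}"
    by (auto simp: Aut_TP1_def)
  then have "x \<circ> y = TP1_map (e * e') (e * b' + b)" "e * e' \<in> {1, -1}"
    by (auto simp: TP1_map_comp)
  then show "x \<otimes>\<^bsub>Aut_TP1\<^esub> y \<in> carrier Aut_TP1"
    unfolding Aut_TP1_def by auto
next
  show "\<one>\<^bsub>Aut_TP1\<^esub> \<in> carrier Aut_TP1"
    using TP1_map_id[symmetric] by (auto simp: Aut_TP1_def)
qed (auto simp: Aut_TP1_def)

lemma subgroup_Aut_map: "subgroup (carrier (Aut_map f)) (Aut_TP1 \<times>\<times> Aut_TP1)"
proof -
  interpret A: group Aut_TP1 by (rule group_Aut_TP1)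
  interpret P: group "Aut_TP1 \<times>\<times> Aut_TP1"
    by (rule DirProd_group[OF group_Aut_TP1 group_Aut_TP1])
  have mult: "x \<otimes>\<^bsub>Aut_TP1\<^esub> y = x \<circ> y" and one: "\<one>\<^bsub>Aut_TP1\<^esub> = id" for x y
    by (auto simp: Aut_TP1_def)
  show ?thesis
  proof (rule P.subgroupI)
    show "carrier (Aut_map f) \<subseteq> carrier (Aut_TP1 \<times>\<times> Aut_TP1)"
      by (auto simp: Aut_map_def)
    have "(id, id) \<in> carrier (Aut_map f)"
      using A.one_closed by (auto simp: Aut_map_def one)
    then show "carrier (Aut_map f) \<noteq> {}" by auto
  next
    fix p assume "p \<in> carrier (Aut_map f)"
    then obtain a b where p: "p = (a, b)" "a \<in> carrier Aut_TP1" "b \<in> carrier Aut_TP1"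
      and eq: "b \<circ> extend_TP1 f = extend_TP1 f \<circ> a"
      by (auto simp: Aut_map_def)
    let ?a = "inv\<^bsub>Aut_TP1\<^esub> a" and ?b = "inv\<^bsub>Aut_TP1\<^esub> b"
    have a: "a \<circ> ?a = id" and b: "?b \<circ> b = id"
      using A.r_inv[OF p(2)] A.l_inv[OF p(3)] by (auto simp: mult one)
    have "?b \<circ> extend_TP1 f = ?b \<circ> (extend_TP1 f \<circ> a) \<circ> ?a"
      using a by (simp add: comp_assoc)
    also have "\<dots> = (?b \<circ> b) \<circ> extend_TP1 f \<circ> ?a"
      by (simp only: eq[symmetric] comp_assoc)
    finally have "?b \<circ> extend_TP1 f = extend_TP1 f \<circ> ?a"
      using b by simp
    then show "inv\<^bsub>Aut_TP1 \<times>\<times> Aut_TP1\<^esub> p \<in> carrier (Aut_map f)"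
      using p by (auto simp: Aut_map_def inv_DirProd[OF group_Aut_TP1 group_Aut_TP1])
  next
    fix p q assume "p \<in> carrier (Aut_map f)" "q \<in> carrier (Aut_map f)"
    then obtain a b c d where
      p: "p = (a, b)" "a \<in> carrier Aut_TP1" "b \<in> carrier Aut_TP1"
        "b \<circ> extend_TP1 f = extend_TP1 f \<circ> a" and
      q: "q = (c, d)" "c \<in> carrier Aut_TP1" "d \<in> carrier Aut_TP1"
        "d \<circ> extend_TP1 f = extend_TP1 f \<circ> c"
      by (auto simp: Aut_map_def)
    have "(b \<circ> d) \<circ> extend_TP1 f = extend_TP1 f \<circ> (a \<circ> c)"
      by (metis comp_assoc p(4) q(4))
    then show "p \<otimes>\<^bsub>Aut_TP1 \<times>\<times> Aut_TP1\<^esub> q \<in> carrier (Aut_map f)"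
      using p q A.m_closed[of a c] A.m_closed[of b d] by (auto simp: Aut_map_def mult)
  qed
qed

lemma group_Aut_map: "group (Aut_map f)"
proof -
  interpret P: group "Aut_TP1 \<times>\<times> Aut_TP1"
    by (rule DirProd_group[OF group_Aut_TP1 group_Aut_TP1])
  have "Aut_map f = (Aut_TP1 \<times>\<times> Aut_TP1)\<lparr>carrier := carrier (Aut_map f)\<rparr>"
    by (simp add: Aut_map_def)
  then show ?thesis
    using P.subgroup_imp_group[OF subgroup_Aut_map[of f]] by simp
qed

end

theory Submission
  imports Defs "HOL-Analysis.Abstract_Topology_2"
begin

text \<open>
  A map with slopes \<open>(3, 3 \<plusminus> 2, 3)\<close> has exactly two break points \<open>p < q\<close>, and up to an additive
  constant it is the line of slope 3 perturbed by \<open>\<plusminus>(\<bar>t - p\<bar> - \<bar>t - q\<bar>)\<close>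
  (\<open>three_slopes_closed_form\<close>). The perturbation is odd about the midpoint of the two break points,
  so the graph has a point symmetry (\<open>kinked_reflect\<close>), and this is the
  nontrivial automorphism.

  Nothing else is possible. The map is strictly increasing, which forces \<open>\<alpha>\<close> and \<open>\<beta>\<close> to have the
  same sign. A pair of translations is trivial because the perturbation is constant on the
  unbounded pieces and nowhere else, so it has no nonzero period (\<open>kinked_translation_trivial\<close>).
  If both signs are \<open>-1\<close>, composing with the point symmetry gives a pair of translations, so the
  pair is the point symmetry itself. Hence the automorphism group has order two.
\<close>

section \<open>Groups of order two\<close>

lemma (in group) two_element_group_iso:
  assumes carrier: "carrier G = {\<one>, x}" and neq: "x \<noteq> \<one>"
  shows "G \<cong> integer_mod_group 2"
proof -
  have x: "x \<in> carrier G"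
    using carrier by simp
  have "x \<otimes> x \<noteq> x"
    using x neq l_cancel_one by blast
  then have sq: "x \<otimes> x = \<one>"
    using m_closed[OF x x] carrier by auto
  define h :: "'a \<Rightarrow> int" where "h y = (if y = \<one> then 0 else 1)" for y
  have "h \<in> hom G (integer_mod_group 2)"
    unfolding hom_def using x sq neq
    by (auto simp: carrier h_def carrier_integer_mod_group)
  moreover have "bij_betw h (carrier G) (carrier (integer_mod_group 2))"
    using neq unfolding bij_betw_def
    by (auto simp: carrier h_def carrier_integer_mod_group image_iff)
  ultimately show ?thesis
    by (intro is_isoI) (simp add: iso_def)
qed

section \<open>A closed form for maps with two break points\<close>

definition kinked :: "real \<Rightarrow> real \<Rightarrow> real \<Rightarrow> real \<Rightarrow> real \<Rightarrow> real" where
  "kinked p q c d t = 3 * t + c + d * (\<bar>t - p\<bar> - \<bar>t - q\<bar>)"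

text \<open>The definition of \<^const>\<open>slopes\<close> describes the map on the open pieces only; continuity carries
  the affine formula to the break points, where neighbouring formulas must then agree.\<close>

lemma affine_on_closure:
  fixes f :: "real \<Rightarrow> real"
  assumes "continuous_on UNIV f" and "\<And>t. t \<in> S \<Longrightarrow> f t = s * t + c" and "t \<in> closure S"
  shows "f t = s * t + c"
proof -
  have "continuous_on (closure S) (\<lambda>t. f t - s * t)"
    by (intro continuous_intros continuous_on_subset[OF assms(1)]) auto
  then have "f t - s * t = c"
    by (rule continuous_constant_on_closure) (use assms in auto)
  then show ?thesis by simp
qed

lemma three_slopes_closed_form:
  assumes "slope_sequence f [3, s, 3]"
  shows "\<exists>p q c. p < q \<and> f = kinked p q c ((of_int s - 3) / 2)"
proof -
  from assms obtain xs where sl: "slopes f xs [3, s, 3]"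
    by (auto simp: slope_sequence_def)
  then have "length xs = 2"
    by (simp add: slopes_def)
  then obtain p q where xs: "xs = [p, q]"
    by (auto simp: length_Suc_conv numeral_2_eq_2)
  have cont: "continuous_on UNIV f" and pq: "p < q"
    using sl by (auto simp: slopes_def xs)
  have aff: "\<exists>c. \<forall>t \<in> piece xs i. f t = of_int ([3, s, 3] ! i) * t + c" if "i \<le> 2" for i
    using sl that by (auto simp: slopes_def xs)
  have pieces: "piece xs 0 = {..<p}" "piece xs 1 = {p<..<q}" "piece xs 2 = {q<..}"
    using pq by (auto simp: piece_def xs)
  obtain c0 where "\<And>t. t \<in> {..<p} \<Longrightarrow> f t = 3 * t + c0"
    using aff[of 0] by (auto simp: pieces)
  then have f0: "f t = 3 * t + c0" if "t \<le> p" for t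
    using affine_on_closure[OF cont, of "{..<p}" 3 c0 t] that by simp
  obtain c1 where "\<And>t. t \<in> {p<..<q} \<Longrightarrow> f t = of_int s * t + c1"
    using aff[of 1] pieces by auto
  then have f1: "f t = of_int s * t + c1" if "p \<le> t" "t \<le> q" for t
    using affine_on_closure[OF cont, of "{p<..<q}" "of_int s" c1 t] that pq by simp
  obtain c2 where "\<And>t. t \<in> {q<..} \<Longrightarrow> f t = 3 * t + c2"
    using aff[of 2] pieces by auto
  then have f2: "f t = 3 * t + c2" if "q \<le> t" for t
    using affine_on_closure[OF cont, of "{q<..}" 3 c2 t] that by simp
  define d where "d = (of_int s - 3) / (2::real)"
  have s: "of_int s = 3 + 2 * d"
    by (simp add: d_def field_simps)
  have c1: "c1 = c0 - 2 * d * p"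
    using f0[of p] f1[of p] pq unfolding s by (simp add: algebra_simps)
  have c2: "c2 = c1 + 2 * d * q"
    using f1[of q] f2[of q] pq unfolding s by (simp add: algebra_simps)
  \<comment> \<open>On the left piece the two absolute values contribute \<open>d * (p - q)\<close>.\<close>
  have "f t = kinked p q (c0 + d * (q - p)) d t" for t
  proof -
    consider "t \<le> p" | "p \<le> t" "t \<le> q" | "q \<le> t" by linarith
    then show ?thesis
      by cases (use pq in \<open>simp_all add: f0 f1 f2 s c1 c2 kinked_def algebra_simps\<close>)
  qed
  then show ?thesis
    using pq unfolding d_def by blast
qed

section \<open>Symmetries on the real line\<close>

lemma kinked_reflect: "kinked p q c d (p + q - t) = 3 * (p + q) + 2 * c - kinked p q c d t"
proof -
  have "\<bar>p + q - t - p\<bar> = \<bar>t - q\<bar>" "\<bar>p + q - t - q\<bar> = \<bar>t - p\<bar>" by auto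
  then show ?thesis
    unfolding kinked_def by (simp add: algebra_simps)
qed

lemma kinked_strict_mono:
  assumes "d \<in> {1, -1}" and "t < u"
  shows "kinked p q c d t < kinked p q c d u"
  using assms unfolding kinked_def by (auto simp: abs_if)

text \<open>Far to the right both sides are affine with slope 3, so the two translation lengths satisfy
  \<open>b = 3 * a\<close> and the perturbation has period \<open>a\<close>. But it takes its value at \<open>q\<close> exactly on
  \<open>[q, \<infinity>)\<close>, which contains only one of \<open>q - \<bar>a\<bar>\<close> and \<open>q\<close> unless \<open>a = 0\<close>.\<close>

lemma kinked_translation_trivial:
  assumes d: "d \<in> {1, -1}" and pq: "p < q"
    and eq: "\<And>t. kinked p q c d t + b = kinked p q c d (t + a)"
  shows "a = 0 \<and> b = 0"
proof -
  have right: "kinked p q c d t = 3 * t + c + d * (q - p)" if "q \<le> t" for t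
    using that pq by (simp add: kinked_def)
  have b: "b = 3 * a"
    using eq[of "q + \<bar>a\<bar>"] right[of "q + \<bar>a\<bar>"] right[of "q + \<bar>a\<bar> + a"]
    by (simp add: algebra_simps)
  have left: "kinked p q c d t \<noteq> 3 * t + c + d * (q - p)" if "t < q" for t
    using that pq d by (auto simp: kinked_def)
  have "\<not> a < 0"
    using eq[of q] left[of "q + a"] right[of q] b by auto
  moreover have "\<not> 0 < a"
    using eq[of "q - a"] left[of "q - a"] right[of q] b by auto
  ultimately show ?thesis
    using b by simp
qed

lemma kinked_symmetry_cases:
  assumes d: "d \<in> {1, -1}" and pq: "p < q" and e: "e \<in> {1, -1}" "e' \<in> {1, -1}"
    and eq: "\<And>t. e' * kinked p q c d t + b = kinked p q c d (e * t + a)"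
  shows "e = 1 \<and> e' = 1 \<and> a = 0 \<and> b = 0 \<or>
    e = -1 \<and> e' = -1 \<and> a = p + q \<and> b = 3 * (p + q) + 2 * c"
proof -
  have lt: "kinked p q c d 0 < kinked p q c d 1"
    using d by (rule kinked_strict_mono) simp
  have "e' = e"
    using e eq[of 0] eq[of 1] lt kinked_strict_mono[OF d, of a "1 + a" p q c]
      kinked_strict_mono[OF d, of "a - 1" a p q c]
    by (auto simp: add.commute)
  consider "e = 1" | "e = -1" using e by auto
  then show ?thesis
  proof cases
    case 1
    then show ?thesis
      using kinked_translation_trivial[OF d pq, of c b a] eq \<open>e' = e\<close> by (simp add: add.commute)
  next
    case 2
    \<comment> \<open>Precomposing with the point symmetry \<open>t \<mapsto> p + q - t\<close> leaves a pair of translations.\<close>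
    have "kinked p q c d t + (b - (3 * (p + q) + 2 * c)) = kinked p q c d (t + (a - (p + q)))" for t
      using eq[of "p + q - t"] kinked_reflect[of p q c d t] 2 \<open>e' = e\<close>
      by (simp add: algebra_simps)
    from kinked_translation_trivial[OF d pq this] show ?thesis
      using 2 \<open>e' = e\<close> by auto
  qed
qed

section \<open>Behaviour at infinity and the automorphism group\<close>

lemma extend_TP1_real [simp]: "extend_TP1 f (ereal t) = ereal (f t)"
  by (simp add: extend_TP1_def)

text \<open>The perturbation is bounded by \<open>\<bar>d\<bar> * \<bar>p - q\<bar>\<close>, so the map fixes both points at infinity.\<close>

lemma kinked_bounds:
  "3 * t + c - \<bar>d\<bar> * \<bar>p - q\<bar> \<le> kinked p q c d t" "kinked p q c d t \<le> 3 * t + c + \<bar>d\<bar> * \<bar>p - q\<bar>"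
proof -
  have "\<bar>d * (\<bar>t - p\<bar> - \<bar>t - q\<bar>)\<bar> \<le> \<bar>d\<bar> * \<bar>p - q\<bar>"
    unfolding abs_mult by (intro mult_left_mono) auto
  then show "3 * t + c - \<bar>d\<bar> * \<bar>p - q\<bar> \<le> kinked p q c d t"
    "kinked p q c d t \<le> 3 * t + c + \<bar>d\<bar> * \<bar>p - q\<bar>"
    unfolding kinked_def by linarith+
qed

lemma extend_TP1_kinked_infinity:
  "extend_TP1 (kinked p q c d) \<infinity> = \<infinity>" "extend_TP1 (kinked p q c d) (-\<infinity>) = -\<infinity>"
proof -
  let ?K = "\<bar>d\<bar> * \<bar>p - q\<bar>"
  have "((\<lambda>t. ereal (kinked p q c d t)) \<longlongrightarrow> \<infinity>) at_top"
    unfolding tendsto_PInfty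
  proof
    fix r
    show "\<forall>\<^sub>F t in at_top. ereal r < ereal (kinked p q c d t)"
      using eventually_gt_at_top[of "(r - c + ?K) / 3"]
    proof eventually_elim
      case (elim t)
      then show ?case
        using kinked_bounds(1)[of t c d p q] by simp
    qed
  qed
  from tendsto_Lim[OF _ this] show "extend_TP1 (kinked p q c d) \<infinity> = \<infinity>"
    by (simp add: extend_TP1_def flip: PInfty_eq_infinity)
  have "((\<lambda>t. ereal (kinked p q c d t)) \<longlongrightarrow> -\<infinity>) at_bot"
    unfolding tendsto_MInfty
  proof
    fix r
    show "\<forall>\<^sub>F t in at_bot. ereal (kinked p q c d t) < ereal r"
      using eventually_gt_at_bot[of "(r - c - ?K) / 3"]
    proof eventually_elim
      case (elim t)
      then show ?case
        using kinked_bounds(2)[of p q c d t] by simp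
    qed
  qed
  from tendsto_Lim[OF _ this] show "extend_TP1 (kinked p q c d) (-\<infinity>) = -\<infinity>"
    by (simp add: extend_TP1_def flip: MInfty_eq_minfinity)
qed

lemma carrier_Aut_map_kinked:
  assumes d: "d \<in> {1, -1}" and pq: "p < q"
  shows "carrier (Aut_map (kinked p q c d)) =
    {(id, id), (TP1_map (-1) (p + q), TP1_map (-1) (3 * (p + q) + 2 * c))}"
    (is "carrier (Aut_map ?f) = {(id, id), (?\<sigma>, ?\<tau>)}")
proof (intro equalityI subsetI)
  fix z assume "z \<in> carrier (Aut_map ?f)"
  then obtain e a e' b where z: "z = (TP1_map e a, TP1_map e' b)"
    and e: "e \<in> {1, -1}" "e' \<in> {1, -1}"
    and eq: "TP1_map e' b \<circ> extend_TP1 ?f = extend_TP1 ?f \<circ> TP1_map e a"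
    unfolding Aut_map_def Aut_TP1_def by auto
  have "e' * ?f t + b = ?f (e * t + a)" for t
    using fun_cong[OF eq, of "ereal t"] by (simp add: TP1_map_def)
  from kinked_symmetry_cases[OF d pq e this] show "z \<in> {(id, id), (?\<sigma>, ?\<tau>)}"
    using TP1_map_id z by auto
next
  have "?\<tau> (extend_TP1 ?f x) = extend_TP1 ?f (?\<sigma> x)" for x
  proof (cases x)
    case (real t)
    then show ?thesis
      using kinked_reflect[of p q c d t] by (simp add: TP1_map_def)
  qed (simp_all add: TP1_map_def extend_TP1_kinked_infinity)
  then have "?\<tau> \<circ> extend_TP1 ?f = extend_TP1 ?f \<circ> ?\<sigma>"
    by auto
  moreover have "id \<in> carrier Aut_TP1" "?\<sigma> \<in> carrier Aut_TP1" "?\<tau> \<in> carrier Aut_TP1"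
    using TP1_map_id[symmetric] by (auto simp: Aut_TP1_def)
  ultimately show "z \<in> carrier (Aut_map ?f)" if "z \<in> {(id, id), (?\<sigma>, ?\<tau>)}" for z
    using that unfolding Aut_map_def by auto
qed

theorem proposition6:
  fixes \<phi> :: "real \<Rightarrow> real"
  assumes "tropical_rational_map_deg3 \<phi>"
    and "slope_sequence \<phi> [3, 5, 3] \<or> slope_sequence \<phi> [3, 1, 3]"
  shows "Aut_map \<phi> \<cong> integer_mod_group 2"
proof -
  obtain p q c d where pq: "p < q" and d: "d \<in> {1, -1}" and \<phi>: "\<phi> = kinked p q c d"
    using assms(2)
  proof
    assume "slope_sequence \<phi> [3, 5, 3]"
    from three_slopes_closed_form[OF this] show ?thesis
      using that[where d = 1] by auto
  next
    assume "slope_sequence \<phi> [3, 1, 3]"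
    from three_slopes_closed_form[OF this] show ?thesis
      using that[where d = "-1"] by auto
  qed
  let ?x = "(TP1_map (-1) (p + q), TP1_map (-1) (3 * (p + q) + 2 * c))"
  have one: "\<one>\<^bsub>Aut_map \<phi>\<^esub> = (id, id)"
    by (simp add: Aut_map_def DirProd_def Aut_TP1_def)
  have "TP1_map (-1) (p + q) \<infinity> \<noteq> id \<infinity>"
    by (simp add: TP1_map_def)
  then have "?x \<noteq> \<one>\<^bsub>Aut_map \<phi>\<^esub>"
    unfolding one by auto
  moreover have "carrier (Aut_map \<phi>) = {\<one>\<^bsub>Aut_map \<phi>\<^esub>, ?x}"
    unfolding one unfolding \<phi> by (rule carrier_Aut_map_kinked[OF d pq])
  ultimately show ?thesis
    by (intro group.two_element_group_iso[OF group_Aut_map])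
qed

end
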